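(* If $T$ is an orientation of a caterpillar whose central path $P$ is a directed path, then $\chi_{d}(T)=\chi_{d}(P)$.
   Context: A caterpillar is a finite tree in which every vertex is at distance at most one from a central path; the central path $P$ is taken to be a longest path of the underlying undirected tree, and it carries the orientation induced from $T$. That $P=v_{1}\dots v_{m}$ is a directed path means that its arcs are $(v_{i},v_{i+1})$ for $1\leq i\leq m-1$. An orientation replaces each edge by exactly one of the two possible arcs. For a vertex $v$ of a digraph $D$, $N^{+}(v)$ denotes the open out-neighborhood (in $D$), i.e. the set of vertices $w$ such that $(v,w)$ is an arc; $v$ dominates each vertex of $N^{+}(v)$. A dominator coloring of $D$ is a proper vertex coloring (adjacent vertices of the underlying graph receive different colors) such that every vertex $v$ with $N^{+}(v)\neq\emptyset$ dominates at least one color class, i.e. there is a nonempty color class contained in $N^{+}(v)$ (vertices of out-degree zero are exempt). The dominator chromatic number $\chi_{d}(D)$ is the minimum number of colors in a dominator coloring of $D$. *)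

theory Defs
  imports "Graph_Theory.Graph_Theory"
begin

text \<open>
  Undirected finite simple graphs are loopfree symmetric digraphs (\<^locale>\<open>pair_graph\<close>).
  The library predicate \<^const>\<open>tree\<close> is unsuitable for them: it counts the back-and-forth
  walk along a single edge as a cycle. Hence only cycles with at least three arcs are excluded.
\<close>

definition undirected_tree :: "'a pair_pre_digraph \<Rightarrow> bool" where
  "undirected_tree G \<longleftrightarrow>
    pair_graph G \<and> connected (with_proj G) \<and>
    (\<nexists>q. pre_digraph.cycle (with_proj G) q \<and> 3 \<le> length q)"

definition graph_dist :: "'a pair_pre_digraph \<Rightarrow> 'a \<Rightarrow> 'a \<Rightarrow> ereal" where
  "graph_dist G u v = wf_digraph.\<mu> (with_proj G) (\<lambda>_. 1) u v"

definition longest_path :: "'a pair_pre_digraph \<Rightarrow> 'a vwalk \<Rightarrow> bool" where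
  "longest_path G p \<longleftrightarrow>
    vpath p (with_proj G) \<and>
    (\<forall>q. vpath q (with_proj G) \<longrightarrow> vwalk_length q \<le> vwalk_length p)"

definition central_path :: "'a pair_pre_digraph \<Rightarrow> 'a vwalk \<Rightarrow> bool" where
  "central_path G p \<longleftrightarrow>
    longest_path G p \<and> (\<forall>v \<in> pverts G. \<exists>w \<in> set p. graph_dist G v w \<le> 1)"

definition caterpillar :: "'a pair_pre_digraph \<Rightarrow> bool" where
  "caterpillar G \<longleftrightarrow> undirected_tree G \<and> (\<exists>p. central_path G p)"

definition orientation_of :: "'a pair_pre_digraph \<Rightarrow> 'a pair_pre_digraph \<Rightarrow> bool" where
  "orientation_of T G \<longleftrightarrow>
    pverts T = pverts G \<and> parcs T \<subseteq> parcs G \<and>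
    (\<forall>(u, v) \<in> parcs G. ((u, v) \<in> parcs T) \<noteq> ((v, u) \<in> parcs T))"

text \<open>A path of the underlying graph of \<open>T\<close>, as a digraph with the orientation induced from \<open>T\<close>.\<close>

definition oriented_path :: "'a pair_pre_digraph \<Rightarrow> 'a vwalk \<Rightarrow> 'a pair_pre_digraph" where
  "oriented_path T p =
    \<lparr> pverts = set p,
      parcs = parcs T \<inter> (set (vwalk_arcs p) \<union> (set (vwalk_arcs p))\<inverse>) \<rparr>"

definition is_directed_path :: "'a pair_pre_digraph \<Rightarrow> 'a vwalk \<Rightarrow> bool" where
  "is_directed_path P p \<longleftrightarrow>
    p \<noteq> [] \<and> distinct p \<and> pverts P = set p \<and> parcs P = set (vwalk_arcs p)"

definition out_nbhd :: "('a, 'b) pre_digraph \<Rightarrow> 'a \<Rightarrow> 'a set" where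
  "out_nbhd D v = {w. v \<rightarrow>\<^bsub>D\<^esub> w}"

definition proper_coloring :: "('a, 'b) pre_digraph \<Rightarrow> ('a \<Rightarrow> nat) \<Rightarrow> bool" where
  "proper_coloring D c \<longleftrightarrow> (\<forall>u v. u \<rightarrow>\<^bsub>D\<^esub> v \<longrightarrow> c u \<noteq> c v)"

text \<open>Indexing by the colors actually used makes all color classes nonempty.\<close>

definition color_classes :: "('a, 'b) pre_digraph \<Rightarrow> ('a \<Rightarrow> nat) \<Rightarrow> 'a set set" where
  "color_classes D c = (\<lambda>k. {u \<in> verts D. c u = k}) ` (c ` verts D)"

definition dominator_coloring :: "('a, 'b) pre_digraph \<Rightarrow> ('a \<Rightarrow> nat) \<Rightarrow> bool" where
  "dominator_coloring D c \<longleftrightarrow>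
    proper_coloring D c \<and>
    (\<forall>v \<in> verts D. out_nbhd D v \<noteq> {} \<longrightarrow> (\<exists>K \<in> color_classes D c. K \<subseteq> out_nbhd D v))"

text \<open>For finite loopfree digraphs an injective coloring shows that the minimum exists.\<close>

definition dominator_chromatic_number :: "('a, 'b) pre_digraph \<Rightarrow> nat" where
  "dominator_chromatic_number D =
    (LEAST k. \<exists>c. dominator_coloring D c \<and> card (c ` verts D) = k)"

end

theory Submission
  imports Defs
begin

text \<open>
  Both numbers equal the number \<open>m\<close> of vertices of the central path \<open>v\<^sub>1 \<dots> v\<^sub>m\<close>.

  Lower bound: each of \<open>v\<^sub>1, \<dots>, v\<^sub>m\<^sub>-\<^sub>1\<close> has an out-neighbour and hence dominates a color
  class. In a tree the out-neighborhoods of these vertices are pairwise disjoint, because a path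
  vertex \<open>v\<^sub>i\<^sub>+\<^sub>1\<close> is an out-neighbour of \<open>v\<^sub>i\<close> only and a vertex off the path has just one neighbour
  on it. So the \<open>m - 1\<close> dominated classes are distinct. None of them contains \<open>v\<^sub>1\<close>, which has
  in-degree zero as the first vertex of a directed longest path, and the class of \<open>v\<^sub>1\<close> is one more.

  Upper bound: give \<open>v\<^sub>2, \<dots>, v\<^sub>m\<close> private colors and all remaining vertices one further color. The
  latter, \<open>v\<^sub>1\<close> and the vertices off the path, are pairwise nonadjacent: a longest path cannot be
  prolonged beyond \<open>v\<^sub>1\<close>, and an edge between two vertices off the path, both attached to it, would
  close a cycle. Every vertex with an out-neighbour then has one among
  \<open>v\<^sub>2, \<dots>, v\<^sub>m\<close>, and this out-neighbour alone is a color class.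

  The argument uses only a few adjacency properties shared by \<open>T\<close> and by \<open>P\<close> itself. They are
  collected in the locale \<open>directed_spine\<close>, where the value \<open>m\<close> is computed once for both digraphs
  (\<open>dominator_chromatic_number_eq_length\<close>). For \<open>T\<close> they follow from acyclicity of the tree
  (\<open>undirected_tree_no_chord\<close>) and maximality of the path (\<open>longest_path_ends\<close>).
\<close>

section \<open>Vertex walks and their arcs\<close>

lemma set_vwalk_arcs_conv_nth:
  "set (vwalk_arcs p) = {(p ! i, p ! Suc i) | i. Suc i < length p}"
proof (induction p rule: vwalk_arcs.induct)
  case (3 x y xs)
  show ?case (is "?L = ?R")
  proof
    show "?L \<subseteq> ?R"
    proof
      fix a assume "a \<in> ?L"
      then consider "a = (x, y)"
        | i where "a = ((y # xs) ! i, (y # xs) ! Suc i)" "Suc i < length (y # xs)"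
        using 3 by auto
      then show "a \<in> ?R"
      proof cases
        case 1
        then show ?thesis by (auto intro: exI[of _ 0])
      next
        case (2 i)
        then show ?thesis by (auto intro: exI[of _ "Suc i"])
      qed
    qed
    show "?R \<subseteq> ?L"
    proof
      fix a assume "a \<in> ?R"
      then obtain i where "a = ((x # y # xs) ! i, (x # y # xs) ! Suc i)" "Suc i < length (x # y # xs)"
        by blast
      then show "a \<in> ?L" using 3 by (cases i) auto
    qed
  qed
qed auto

lemma pcas_vwalk_arcs: "q \<noteq> [] \<Longrightarrow> pcas (hd q) (vwalk_arcs q) (last q)"
  by (induction q rule: vwalk_arcs.induct) auto

lemma pawalk_verts_vwalk_arcs: "q \<noteq> [] \<Longrightarrow> pawalk_verts (hd q) (vwalk_arcs q) = q"
  by (induction q rule: vwalk_arcs.induct) auto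

lemma vwalk_snocI:
  assumes "vwalk q D" "w \<in> verts D" "last q \<rightarrow>\<^bsub>D\<^esub> w"
  shows "vwalk (q @ [w]) D"
  using assms by (auto simp: vwalk_def set_vwalk_arcs_snoc)

lemma vpath_segment:
  assumes "vpath p D" "i \<le> j" "j < length p"
  obtains s where "vpath s D" "set s \<subseteq> set p" "hd s = p ! i" "last s = p ! j"
    "length s = Suc (j - i)"
proof
  let ?s = "drop i (take (Suc j) p)"
  have ne: "?s \<noteq> []" using assms by simp
  have split: "p = take i p @ ?s @ drop (Suc j) p"
  proof -
    have "take i p @ ?s = take (Suc j) p"
      using assms(2) append_take_drop_id[of i "take (Suc j) p"] by (simp add: min_def)
    then show ?thesis by (metis append.assoc append_take_drop_id)
  qed
  from assms(1) have "vwalk p D" "distinct p" by auto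
  then have "vwalk ?s D"
    using ne split by (metis vwalkI_append_l vwalkI_append_r Nil_is_append_conv)
  then show "vpath ?s D" using \<open>distinct p\<close> by auto
  show "set ?s \<subseteq> set p" by (meson set_drop_subset set_take_subset subset_trans)
  show "hd ?s = p ! i" using assms by (simp add: hd_drop_conv_nth)
  have "last ?s = ?s ! (j - i)" using assms ne by (simp add: last_conv_nth min_absorb2)
  then show "last ?s = p ! j" using assms by simp
  show "length ?s = Suc (j - i)" using assms by simp
qed

section \<open>Trees and caterpillars\<close>

text \<open>
  Otherwise closing the path would give a cycle with at least three arcs. The next three lemmas
  apply this to a segment of \<open>p\<close>, extended by zero, one or two vertices off \<open>p\<close>.
\<close>

lemma undirected_tree_no_chord:
  assumes tree: "undirected_tree G" and q: "vpath q (with_proj G)" and len: "3 \<le> length q"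
  shows "(last q, hd q) \<notin> parcs G"
proof
  assume closing: "(last q, hd q) \<in> parcs G"
  interpret pair_graph G using tree by (simp add: undirected_tree_def)
  let ?r = "q @ [hd q]"
  from q have ne: "q \<noteq> []" and "distinct q" and w: "vwalk q (with_proj G)" by auto
  have "set (vwalk_arcs ?r) \<subseteq> parcs G" "hd q \<in> pverts G"
    using w ne closing by (auto simp: vwalk_def set_vwalk_arcs_snoc)
  then have "awalk (hd q) (vwalk_arcs ?r) (hd q)"
    using pcas_vwalk_arcs[of ?r] ne by (simp add: awalk_def)
  moreover have "distinct (tl (pawalk_verts (hd q) (vwalk_arcs ?r)))"
    using pawalk_verts_vwalk_arcs[of ?r] ne \<open>distinct q\<close>
    by (cases q) auto
  moreover have "length (vwalk_arcs ?r) = length q"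
    using vwalk_length_simp[of ?r] by (simp only: vwalk_length_def) simp
  ultimately have "cycle (vwalk_arcs ?r)" "3 \<le> length (vwalk_arcs ?r)"
    using len by (auto simp: cycle_def)
  then show False using tree by (auto simp: undirected_tree_def)
qed

lemma undirected_tree_path_induced:
  assumes tree: "undirected_tree G" and p: "vpath p (with_proj G)"
    and "i < j" "j < length p" "(p ! i, p ! j) \<in> parcs G"
  shows "j = Suc i"
proof (rule ccontr)
  assume "j \<noteq> Suc i"
  interpret pair_graph G using tree by (simp add: undirected_tree_def)
  obtain s where s: "vpath s (with_proj G)" "hd s = p ! i" "last s = p ! j" "length s = Suc (j - i)"
    using vpath_segment[OF p, of i j] assms by auto
  have "(last s, hd s) \<in> parcs G" using s assms arcs_symmetric by auto
  then show False
    using undirected_tree_no_chord[OF tree s(1)] s(4) \<open>i < j\<close> \<open>j \<noteq> Suc i\<close> by auto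
qed

lemma undirected_tree_unique_attachment:
  assumes tree: "undirected_tree G" and p: "vpath p (with_proj G)" and "x \<notin> set p"
    and "i \<le> j" "j < length p" "(p ! i, x) \<in> parcs G" "(p ! j, x) \<in> parcs G"
  shows "i = j"
proof (rule ccontr)
  assume "i \<noteq> j"
  interpret pair_graph G using tree by (simp add: undirected_tree_def)
  obtain s where s: "vpath s (with_proj G)" "set s \<subseteq> set p" "hd s = p ! i" "last s = p ! j"
      "length s = Suc (j - i)"
    using vpath_segment[OF p, of i j] assms by auto
  have "vpath (x # s) (with_proj G)"
    using s assms arcs_symmetric by (auto intro!: vpathI vwalk_wf_digraph_consI)
  moreover have "3 \<le> length (x # s)" using s(5) \<open>i \<le> j\<close> \<open>i \<noteq> j\<close> by simp
  moreover have "(last (x # s), hd (x # s)) \<in> parcs G" using s(4,5) assms by auto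
  ultimately show False using undirected_tree_no_chord[OF tree] by blast
qed

lemma undirected_tree_neighbours_not_adjacent:
  assumes tree: "undirected_tree G" and p: "vpath p (with_proj G)"
    and "x \<notin> set p" "y \<notin> set p" "x \<noteq> y"
    and "i \<le> j" "j < length p" "(x, p ! i) \<in> parcs G" "(p ! j, y) \<in> parcs G"
  shows "(y, x) \<notin> parcs G"
proof -
  interpret pair_graph G using tree by (simp add: undirected_tree_def)
  obtain s where s: "vpath s (with_proj G)" "set s \<subseteq> set p" "hd s = p ! i" "last s = p ! j"
      "length s = Suc (j - i)"
    using vpath_segment[OF p, of i j] assms by auto
  have ne: "s \<noteq> []" using s(5) by auto
  have "vpath (s @ [y]) (with_proj G)"
    using s assms by (auto intro!: vpathI vwalk_snocI dest: in_arcsD2)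
  then have "vpath (x # s @ [y]) (with_proj G)"
    using s assms ne by (auto intro!: vpathI vwalk_wf_digraph_consI)
  then show ?thesis
    using undirected_tree_no_chord[OF tree, of "x # s @ [y]"] ne by (auto simp: Suc_le_eq)
qed

text \<open>
  The distance is an infimum over walks, but walk lengths are integers: an infimum below 2 is
  witnessed by a walk with at most one arc.
\<close>

lemma adjacent_of_graph_dist_le_1:
  assumes "pair_wf_digraph G" "graph_dist G v w \<le> 1" "v \<noteq> w"
  shows "(v, w) \<in> parcs G"
proof -
  interpret pair_wf_digraph G by fact
  have cost: "awalk_cost (\<lambda>_. 1) a = real (length a)" for a
    by (induction a) auto
  have "graph_dist G v w < 2" using assms(2) by (rule le_less_trans) simp
  then obtain a where a: "awalk v a w" "length a < 2"
    by (auto simp: graph_dist_def \<mu>_def INF_less_iff cost)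
  then obtain e where "a = [e]"
    using assms(3) by (cases a) (auto simp: awalk_def)
  then show ?thesis using a by (cases e) (auto simp: awalk_def)
qed

text \<open>A neighbour off the path would prolong it at that end.\<close>

lemma longest_path_ends:
  assumes "pair_graph G" "longest_path G p" "x \<notin> set p"
  shows "(x, hd p) \<notin> parcs G" "(last p, x) \<notin> parcs G"
proof -
  interpret pair_graph G by fact
  from assms have p: "vwalk p (with_proj G)" "distinct p" "p \<noteq> []"
    by (auto simp: longest_path_def)
  have max: "length q \<le> length p" if "vpath q (with_proj G)" for q
  proof -
    have "length q - 1 \<le> length p - 1" using assms(2) that by (simp add: longest_path_def)
    then show ?thesis using p(3) by (cases p) auto
  qed
  show "(x, hd p) \<notin> parcs G"
    using max[of "x # p"] p assms(3) vwalk_wf_digraph_consI[OF p(1), of x]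
    by (auto simp: vpath_def)
  show "(last p, x) \<notin> parcs G"
    using max[of "p @ [x]"] p assms(3) vwalk_snocI[OF p(1), of x]
    by (auto simp: vpath_def dest: in_arcsD2)
qed

section \<open>Digraphs with a directed spine\<close>

text \<open>
  What remains of an oriented caterpillar once its tree structure is forgotten. The bare directed
  path is an instance as well, so that one computation serves both sides of the theorem.
\<close>

locale directed_spine =
  fixes D :: "('a, 'b) pre_digraph" and p :: "'a list"
  assumes finite_verts: "finite (verts D)"
    and spine_nonempty: "p \<noteq> []"
    and spine_distinct: "distinct p"
    and spine_in_verts: "set p \<subseteq> verts D"
    and spine_arc: "Suc i < length p \<Longrightarrow> p ! i \<rightarrow>\<^bsub>D\<^esub> p ! Suc i"
    and spine_arc_only: "\<lbrakk>p ! i \<rightarrow>\<^bsub>D\<^esub> p ! j; i < length p; j < length p\<rbrakk> \<Longrightarrow> j = Suc i"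
    and arc_meets_spine: "u \<rightarrow>\<^bsub>D\<^esub> v \<Longrightarrow> u \<in> set p \<or> v \<in> set p"
    and no_attachment_at_hd: "w \<notin> set p \<Longrightarrow> \<not> hd p \<rightarrow>\<^bsub>D\<^esub> w \<and> \<not> w \<rightarrow>\<^bsub>D\<^esub> hd p"
    and no_attachment_at_last: "w \<notin> set p \<Longrightarrow> \<not> last p \<rightarrow>\<^bsub>D\<^esub> w"
    and attachment_unique:
      "\<lbrakk>p ! i \<rightarrow>\<^bsub>D\<^esub> w; p ! j \<rightarrow>\<^bsub>D\<^esub> w; w \<notin> set p; i < length p; j < length p\<rbrakk> \<Longrightarrow> i = j"
begin

lemma out_nbhd_spine_disjoint:
  assumes "w \<in> out_nbhd D (p ! i)" "w \<in> out_nbhd D (p ! j)" "i < length p" "j < length p"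
  shows "i = j"
proof (cases "w \<in> set p")
  case True
  then obtain k where "k < length p" "w = p ! k" by (auto simp: in_set_conv_nth)
  then have "k = Suc i" "k = Suc j"
    using assms spine_arc_only[of _ k] by (auto simp: out_nbhd_def)
  then show ?thesis by simp
next
  case False
  then show ?thesis using assms attachment_unique[of i w j] by (simp add: out_nbhd_def)
qed

text \<open>
  The injection below sends \<open>0\<close> to the color of the first spine vertex, and \<open>Suc i\<close> to a color
  whose class is dominated by the spine vertex number \<open>i\<close>.
\<close>

lemma length_spine_le_colors:
  assumes "dominator_coloring D c"
  shows "length p \<le> card (c ` verts D)"
proof -
  have dominated: "\<exists>k \<in> c ` verts D. {u \<in> verts D. c u = k} \<subseteq> out_nbhd D (p ! i)"
    if "Suc i < length p" for i
  proof -
    have "p ! i \<in> verts D" "out_nbhd D (p ! i) \<noteq> {}"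
      using spine_in_verts spine_arc[OF that] that by (auto simp: out_nbhd_def)
    then obtain K where "K \<in> color_classes D c" "K \<subseteq> out_nbhd D (p ! i)"
      using assms unfolding dominator_coloring_def by blast
    then show ?thesis by (auto simp: color_classes_def)
  qed
  then obtain k where k: "\<And>i. Suc i < length p \<Longrightarrow> k i \<in> c ` verts D"
    and k_sub: "\<And>i. Suc i < length p \<Longrightarrow> {u \<in> verts D. c u = k i} \<subseteq> out_nbhd D (p ! i)"
    by metis
  define f where "f i = (case i of 0 \<Rightarrow> c (p ! 0) | Suc i' \<Rightarrow> k i')" for i
  have hd_vert: "p ! 0 \<in> verts D" using spine_nonempty spine_in_verts by auto
  have f0: "f 0 \<noteq> f (Suc i)" if "Suc i < length p" for i
  proof
    assume "f 0 = f (Suc i)"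
    then have "p ! 0 \<in> out_nbhd D (p ! i)"
      using k_sub[OF that] hd_vert by (auto simp: f_def)
    then show False
      using spine_arc_only[of i 0] that spine_nonempty by (simp add: out_nbhd_def)
  qed
  have fS: "i = j" if ij: "f (Suc i) = f (Suc j)" "Suc i < length p" "Suc j < length p" for i j
  proof -
    obtain u where u: "u \<in> verts D" "c u = k i" using k[OF ij(2)] by auto
    then have "u \<in> out_nbhd D (p ! i)" "u \<in> out_nbhd D (p ! j)"
      using k_sub[OF ij(2)] k_sub[OF ij(3)] ij(1) by (auto simp: f_def)
    then show ?thesis using out_nbhd_spine_disjoint ij by auto
  qed
  have "inj_on f {..<length p}"
  proof (rule inj_onI)
    fix i j assume "i \<in> {..<length p}" "j \<in> {..<length p}" "f i = f j"
    then show "i = j"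
      using f0 fS by (cases i; cases j) (auto, metis)
  qed
  moreover have "f ` {..<length p} \<subseteq> c ` verts D"
    using k hd_vert by (auto simp: f_def split: nat.split)
  ultimately show ?thesis
    using card_inj_on_le[of f "{..<length p}" "c ` verts D"] finite_verts by simp
qed

text \<open>
  The spine is colored by position, so the first spine vertex has color \<open>0\<close>, and the same color is
  used for everything off the spine. Then each positive color belongs to one spine vertex only, and
  it suffices that every vertex with an out-neighbour has one at a positive position.
\<close>

lemma ex_coloring_length_spine:
  "\<exists>c. dominator_coloring D c \<and> card (c ` verts D) = length p"
proof -
  define c where "c v = (if v \<in> set p then inv_into {..<length p} ((!) p) v else 0)" for v
  have inj: "inj_on ((!) p) {..<length p}"
    using spine_distinct by (simp add: inj_on_nth)
  have c_spine: "c (p ! i) = i" if "i < length p" for i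
    using that inj by (simp add: c_def inv_into_f_f)
  have c_off: "c v = 0" if "v \<notin> set p" for v using that by (simp add: c_def)
  have c_pos: "v = p ! i" if "c v = i" "0 < i" for v i
    using that c_off[of v] c_spine by (cases "v \<in> set p") (auto simp: in_set_conv_nth)
  have hd: "hd p = p ! 0" using spine_nonempty by (simp add: hd_conv_nth)
  have off_spine: "0 < i" if "w \<notin> set p" "p ! i \<rightarrow>\<^bsub>D\<^esub> w \<or> w \<rightarrow>\<^bsub>D\<^esub> p ! i" for i w
    using no_attachment_at_hd[OF that(1)] that(2) hd by (cases i) auto
  have "c u \<noteq> c v" if "u \<rightarrow>\<^bsub>D\<^esub> v" for u v
  proof (cases "u \<in> set p \<and> v \<in> set p")
    case True
    then obtain i j where "u = p ! i" "v = p ! j" "i < length p" "j < length p"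
      by (auto simp: in_set_conv_nth)
    then show ?thesis using spine_arc_only[of i j] that c_spine by auto
  next
    case False
    then show ?thesis
      using arc_meets_spine[OF that] that off_spine c_spine c_off
      by (auto simp: in_set_conv_nth) (metis less_numeral_extra(3) in_set_conv_nth)+
  qed
  then have "proper_coloring D c" by (simp add: proper_coloring_def)
  moreover have "\<exists>K \<in> color_classes D c. K \<subseteq> out_nbhd D v"
    if v: "v \<in> verts D" "out_nbhd D v \<noteq> {}" for v
  proof -
    \<comment> \<open>A spine vertex dominates its successor; it has one, as the last spine vertex is a sink.
        A vertex off the spine has its out-neighbours on the spine, away from its first vertex.\<close>
    have "\<exists>j. 0 < j \<and> j < length p \<and> p ! j \<in> out_nbhd D v"
    proof (cases "v \<in> set p")
      case True
      then obtain i where i: "i < length p" "v = p ! i" by (auto simp: in_set_conv_nth)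
      have "Suc i < length p"
      proof (rule ccontr)
        assume "\<not> Suc i < length p"
        with i have last_pos: "i = length p - 1" by simp
        then have last: "v = last p" using i spine_nonempty by (simp add: last_conv_nth)
        obtain w where w: "v \<rightarrow>\<^bsub>D\<^esub> w" using v(2) by (auto simp: out_nbhd_def)
        then have "w \<in> set p" using no_attachment_at_last last by auto
        then obtain j where "j < length p" "w = p ! j" by (auto simp: in_set_conv_nth)
        then show False using spine_arc_only[of i j] w i last_pos by auto
      qed
      then show ?thesis using spine_arc[of i] i by (auto simp: out_nbhd_def)
    next
      case False
      obtain w where w: "v \<rightarrow>\<^bsub>D\<^esub> w" using v(2) by (auto simp: out_nbhd_def)
      then have "w \<in> set p" using arc_meets_spine False by auto
      then show ?thesis using off_spine[OF False] w by (auto simp: in_set_conv_nth out_nbhd_def)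
    qed
    then obtain j where j: "0 < j" "j < length p" "p ! j \<in> out_nbhd D v" by blast
    have "{u \<in> verts D. c u = c (p ! j)} \<in> color_classes D c"
      unfolding color_classes_def using spine_in_verts j(2) nth_mem by blast
    moreover have "{u \<in> verts D. c u = c (p ! j)} \<subseteq> out_nbhd D v"
      using c_pos[of _ j] c_spine j by auto
    ultimately show ?thesis by blast
  qed
  ultimately have "dominator_coloring D c" by (simp add: dominator_coloring_def)
  moreover have "c ` verts D = {..<length p}"
  proof
    show "c ` verts D \<subseteq> {..<length p}"
      using c_spine c_off spine_nonempty by (auto simp: image_subset_iff)
        (metis in_set_conv_nth length_greater_0_conv)
    show "{..<length p} \<subseteq> c ` verts D"
      using c_spine spine_in_verts by (metis image_eqI lessThan_iff nth_mem subset_iff)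
  qed
  ultimately show ?thesis by (metis card_lessThan)
qed

lemma dominator_chromatic_number_eq_length:
  "dominator_chromatic_number D = length p"
  unfolding dominator_chromatic_number_def
  using ex_coloring_length_spine length_spine_le_colors by (intro Least_equality) auto

end

section \<open>Oriented caterpillars\<close>

lemma directed_spine_of_directed_path:
  assumes "is_directed_path P p"
  shows "directed_spine (with_proj P) p"
proof -
  from assms have P: "p \<noteq> []" "distinct p" "pverts P = set p"
    "parcs P = {(p ! i, p ! Suc i) | i. Suc i < length p}"
    by (auto simp: is_directed_path_def set_vwalk_arcs_conv_nth)
  then show ?thesis
    by unfold_locales (auto simp: nth_eq_iff_index_eq dest: nth_mem Suc_lessD)
qed

text \<open>
  A vertex off \<open>p\<close> is adjacent to \<open>p\<close> because its distance to \<open>p\<close> is at most one. Hence an arc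
  avoiding \<open>p\<close> would close a cycle through a segment of \<open>p\<close>.
\<close>

lemma directed_spine_of_oriented_caterpillar:
  assumes tree: "undirected_tree G" and orient: "orientation_of T G"
    and central: "central_path G p"
    and directed: "set (vwalk_arcs p) \<subseteq> parcs T"
  shows "directed_spine (with_proj T) p"
proof -
  interpret pair_graph G using tree by (simp add: undirected_tree_def)
  have longest: "longest_path G p" using central by (simp add: central_path_def)
  then have p: "vpath p (with_proj G)" by (simp add: longest_path_def)
  then have p_props: "p \<noteq> []" "distinct p" "set p \<subseteq> pverts G" by (auto elim!: vpathE vwalkE)
  have verts: "pverts T = pverts G"
    and sub: "\<And>u v. (u, v) \<in> parcs T \<Longrightarrow> (u, v) \<in> parcs G"
    and asym: "\<And>u v. (u, v) \<in> parcs T \<Longrightarrow> (v, u) \<notin> parcs T"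
    using orient by (auto simp: orientation_of_def)
  have arc: "(p ! i, p ! Suc i) \<in> parcs T" if "Suc i < length p" for i
    using directed that by (auto simp: set_vwalk_arcs_conv_nth)
  have attached: "\<exists>i < length p. (v, p ! i) \<in> parcs G" if v: "v \<in> pverts G" "v \<notin> set p" for v
  proof -
    obtain w where "w \<in> set p" "graph_dist G v w \<le> 1"
      using central v(1) by (auto simp: central_path_def)
    then have "(v, w) \<in> parcs G" "w \<in> set p"
      using adjacent_of_graph_dist_le_1[OF pair_wf_digraph] v(2) by auto
    then show ?thesis by (auto simp: in_set_conv_nth)
  qed
  have meets: "u \<in> set p \<or> v \<in> set p" if uv: "(u, v) \<in> parcs G" for u v
  proof (rule ccontr)
    assume off: "\<not> (u \<in> set p \<or> v \<in> set p)"
    obtain i j where i: "i < length p" "(u, p ! i) \<in> parcs G"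
      and j: "j < length p" "(v, p ! j) \<in> parcs G"
      using attached off in_arcsD1[OF uv] in_arcsD2[OF uv] by metis
    note arcs = i j uv arcs_symmetric[OF i(2)] arcs_symmetric[OF j(2)] arcs_symmetric[OF uv]
    have "u \<noteq> v" using no_loops'[OF uv] .
    \<comment> \<open>The lemma on neighbours fixes the order of the attachment positions; swapping the roles of
        \<open>u\<close> and \<open>v\<close> covers the other order.\<close>
    then show False
      using undirected_tree_neighbours_not_adjacent[OF tree p, of u v i j]
        undirected_tree_neighbours_not_adjacent[OF tree p, of v u j i] off arcs
      by (cases "i \<le> j") auto
  qed
  have ends: "(x, hd p) \<notin> parcs G \<and> (hd p, x) \<notin> parcs G \<and> (last p, x) \<notin> parcs G"
    if "x \<notin> set p" for x
    using longest_path_ends[OF pair_graph longest that] arcs_symmetric by blast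
  show ?thesis
  proof (unfold_locales, simp_all add: verts pair_finite_verts p_props arc)
    fix i j assume ij: "(p ! i, p ! j) \<in> parcs T" "i < length p" "j < length p"
    note G_arc = sub[OF ij(1)] arcs_symmetric[OF sub[OF ij(1)]]
    consider "i < j" | "j < i" using no_loops'[OF G_arc(1)] by (metis nat_neq_iff)
    then show "j = Suc i"
    proof cases
      case 1
      then show ?thesis using undirected_tree_path_induced[OF tree p 1] ij G_arc by simp
    next
      case 2
      then have "i = Suc j" using undirected_tree_path_induced[OF tree p 2] ij G_arc by simp
      then show ?thesis using asym[OF ij(1)] arc[of j] ij by simp
    qed
  next
    fix u v assume "(u, v) \<in> parcs T"
    then show "u \<in> set p \<or> v \<in> set p" using meets sub by blast
  next
    fix w assume "w \<notin> set p"
    then show "(hd p, w) \<notin> parcs T \<and> (w, hd p) \<notin> parcs T" "(last p, w) \<notin> parcs T"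
      using ends sub by blast+
  next
    fix i w j
    assume "(p ! i, w) \<in> parcs T" "(p ! j, w) \<in> parcs T" "w \<notin> set p" "i < length p" "j < length p"
    then show "i = j"
      using undirected_tree_unique_attachment[OF tree p, of w i j]
        undirected_tree_unique_attachment[OF tree p, of w j i] sub
      by (cases "i \<le> j") auto
  qed
qed

theorem lemma9:
  fixes G T P :: "'a pair_pre_digraph" and p :: "'a vwalk"
  assumes "caterpillar G"
    and "orientation_of T G"
    and "central_path G p"
    and "P = oriented_path T p"
    and "is_directed_path P p"
  shows "dominator_chromatic_number (with_proj T) = dominator_chromatic_number (with_proj P)"
proof -
  have "undirected_tree G" using assms(1) by (simp add: caterpillar_def)
  moreover have "set (vwalk_arcs p) \<subseteq> parcs T"
    using assms(4,5) by (auto simp: is_directed_path_def oriented_path_def)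
  ultimately have "directed_spine (with_proj T) p"
    using assms directed_spine_of_oriented_caterpillar by blast
  moreover have "directed_spine (with_proj P) p"
    using assms(5) by (rule directed_spine_of_directed_path)
  ultimately show ?thesis
    by (simp add: directed_spine.dominator_chromatic_number_eq_length)
qed

end
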